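(* Let $n$ be a positive integer and let $a,r$ be non-negative integers with $a\leqslant n$. Then, for $j=0,1$, $$ \sum_{k=a}^{n}[2k][k]^{2r}q^{(r+1)(n-k)+jk^2}{2n\brack n-k} \equiv 0\pmod{[n+a]{2n\brack n-a}}. $$
   Context: $q$ is an indeterminate, $[n]=\frac{1-q^n}{1-q}$, $(q;q)_n=(1-q)\cdots(1-q^n)$ with $(q;q)_0=1$, and ${n\brack k}=\frac{(q;q)_n}{(q;q)_k(q;q)_{n-k}}$ for $0\leqslant k\leqslant n$, $0$ otherwise. For a Laurent polynomial $P(q)$ and a polynomial $D(q)$, $P(q)\equiv 0\pmod{D(q)}$ means that $P(q)/D(q)$ is a Laurent polynomial in $q$. *)

theory Defs
  imports "HOL-Computational_Algebra.Computational_Algebra"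
begin

(* Everything lives in the field of fractions of Z[q], so that the quotients below are literal. *)

definition q :: "int poly fract" where
  "q = to_fract [:0, 1:]"

definition qint :: "nat \<Rightarrow> int poly fract" where
  "qint n = (1 - q ^ n) / (1 - q)"

definition qpoch :: "nat \<Rightarrow> int poly fract" where
  "qpoch n = (\<Prod>i=1..n. 1 - q ^ i)"

definition qbinom :: "nat \<Rightarrow> nat \<Rightarrow> int poly fract" where
  "qbinom n k = (if k \<le> n then qpoch n / (qpoch k * qpoch (n - k)) else 0)"

(* Laurent polynomials have integer coefficients. *)
definition laurent_poly :: "int poly fract \<Rightarrow> bool" where
  "laurent_poly f \<longleftrightarrow>
     (\<exists>S c. finite (S :: int set) \<and> f = (\<Sum>i\<in>S. of_int (c i) * q powi i))"

(* The conjunct D \<noteq> 0 excludes the convention x / 0 = 0. *)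
definition cong_zero_mod :: "int poly fract \<Rightarrow> int poly fract \<Rightarrow> bool" where
  "cong_zero_mod P D \<longleftrightarrow> D \<noteq> 0 \<and> laurent_poly (P / D)"

end

theory Submission
  imports Defs
begin

text \<open>
  Everything rests on the identity $q^{n-k}[k]^2 = [n]^2 - [n-k][n+k]$. Since
  $[n-k][n+k]{2n\brack n-k} = [2n][2n-1]{2n-2\brack n-1-k}$, it expresses the sum for
  $(r+1, n)$ through the sums for $(r, n)$ and $(r, n-1)$, in a way compatible with the modulus.
  For $r = 0$ the sum telescopes to $q^{j(n+a^2-a)}[n+a]{2n\brack n-a}$.
\<close>

section \<open>Powers of q and q-integers as images of polynomials\<close>

lemma to_fract_power: "to_fract (x ^ m) = to_fract x ^ m"
  by (induction m) auto

lemma to_fract_of_int: "to_fract (of_int c) = of_int c"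
proof -
  have nat: "to_fract (of_nat m) = of_nat m" for m
    by (induction m) auto
  show ?thesis
    by (cases c rule: int_diff_cases) (simp add: nat)
qed

lemma q_power_eq: "q ^ m = to_fract (monom 1 m)"
  by (simp add: q_def monom_altdef flip: to_fract_power)

lemma one_minus_q_power_nonzero:
  assumes "m > 0"
  shows "1 - q ^ m \<noteq> 0"
proof -
  have "(1::int poly) \<noteq> monom 1 m"
    using assms by (metis degree_1 degree_monom_eq neq0_conv one_neq_zero)
  then have "to_fract (1::int poly) \<noteq> to_fract (monom 1 m)"
    by (simp only: to_fract_eq_iff not_False_eq_True)
  then show ?thesis
    by (simp add: q_power_eq)
qed

lemma one_minus_q_nonzero: "1 - q \<noteq> 0"
  using one_minus_q_power_nonzero[of 1] by simp

lemma qpoch_nonzero: "qpoch m \<noteq> 0"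
  using one_minus_q_power_nonzero by (auto simp: qpoch_def)

lemma qpoch_Suc: "qpoch (Suc m) = qpoch m * (1 - q ^ Suc m)"
  by (simp add: qpoch_def)

lemma qint_0 [simp]: "qint 0 = 0"
  by (simp add: qint_def)

lemma qint_nonzero: "m > 0 \<Longrightarrow> qint m \<noteq> 0"
  using one_minus_q_power_nonzero one_minus_q_nonzero by (simp add: qint_def)

text \<open>Geometric sum. It certifies that q-integers appearing as cofactors in the recursion are
  genuine polynomials.\<close>

lemma qint_eq_to_fract: "qint m = to_fract (\<Sum>i<m. monom 1 i)"
proof -
  have "qint m = (\<Sum>i<m. q ^ i)"
    using one_minus_q_nonzero by (simp add: qint_def sum_gp_strict)
  then show ?thesis
    by (simp add: q_power_eq)
qed

section \<open>Identities for q-binomial coefficients and q-integers\<close>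

lemma qbinom_nonzero: "k \<le> m \<Longrightarrow> qbinom m k \<noteq> 0"
  by (simp add: qbinom_def qpoch_nonzero)

lemma qbinom_0_right [simp]: "qbinom m 0 = 1"
  using qpoch_nonzero[of m] by (simp add: qbinom_def) (simp add: qpoch_def)

text \<open>Absorption: each q-integer cancels the last factor of one Pochhammer symbol in the
  denominator, leaving \<open>qpoch m / (qpoch i * qpoch (m - Suc i))\<close> over
  \<open>1 - q\<close> on both sides.\<close>

lemma qint_mult_qbinom_Suc:
  assumes "i < m"
  shows "qint (Suc i) * qbinom m (Suc i) = qint (m - i) * qbinom m i"
proof -
  obtain l where m: "m = Suc (i + l)"
    using assms less_iff_Suc_add by auto
  show ?thesis
    using one_minus_q_power_nonzero[of "Suc i"] one_minus_q_power_nonzero[of "Suc l"]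
      one_minus_q_nonzero qpoch_nonzero[of i] qpoch_nonzero[of l]
    by (simp add: m qbinom_def qint_def qpoch_Suc Suc_diff_le del: power_Suc)
qed

text \<open>The q-integers on the left cancel the last factors of both lower Pochhammer symbols;
  those on the right are the two last factors of the upper one. With \<open>m\<close> even, this
  links the central rows for consecutive n.\<close>

lemma qint_mult_qint_mult_qbinom:
  assumes "i \<le> m"
  shows "qint (Suc i) * qint (Suc (m - i)) * qbinom (Suc (Suc m)) (Suc i)
    = qint (Suc (Suc m)) * qint (Suc m) * qbinom m i"
proof -
  obtain l where m: "m = i + l"
    using assms le_iff_add by auto
  show ?thesis
    using one_minus_q_power_nonzero[of "Suc i"] one_minus_q_power_nonzero[of "Suc l"]
      one_minus_q_nonzero qpoch_nonzero[of i] qpoch_nonzero[of l]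
    by (simp add: m qbinom_def qint_def qpoch_Suc Suc_diff_le mult_ac del: power_Suc)
qed

lemma q_power_mult_qint_square:
  assumes "k \<le> n"
  shows "q ^ (n - k) * (qint k)\<^sup>2 = (qint n)\<^sup>2 - qint (n - k) * qint (n + k)"
proof -
  obtain l where n: "n = k + l"
    using assms le_iff_add by auto
  \<comment> \<open>With x = \<open>q ^ k\<close> and y = \<open>q ^ l\<close> this reads y(1 - x)^2
    = (1 - xy)^2 - (1 - y)(1 - x^2 y).\<close>
  have "q ^ l * (1 - q ^ k)\<^sup>2 = (1 - q ^ (k + l))\<^sup>2 - (1 - q ^ l) * (1 - q ^ (k + l + k))"
    by (simp add: power_add power2_eq_square algebra_simps)
  moreover have "q ^ l * (qint k)\<^sup>2 = q ^ l * (1 - q ^ k)\<^sup>2 / (1 - q)\<^sup>2"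
    by (simp add: qint_def power_divide)
  ultimately show ?thesis
    by (simp add: n qint_def power_divide power2_eq_square ac_simps flip: diff_divide_distrib)
qed

text \<open>Splits the summand for r = 0, up to its q-binomial, into two parts that telescope after
  absorption. On expanding the right side over \<open>1 - q\<close>, the constants cancel for j = 0
  and the two terms \<open>q ^ (2 * n + k * k)\<close> cancel for j = 1.\<close>

lemma qint_double_telescope:
  assumes "k \<le> n" and "j \<in> {0, 1}"
  shows "qint (2 * k) * q ^ (n - k + j * k\<^sup>2)
    = q ^ (j * (n + k * (k - 1))) * qint (n + k) - q ^ (j * (n + Suc k * k)) * qint (n - k)"
proof -
  obtain l where n: "n = k + l"
    using assms le_iff_add by auto
  \<comment> \<open>Truncation of \<open>k - 1\<close> at k = 0 is harmless because of the factor
    \<open>k\<close>.\<close>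
  have kk: "k + k * (k - 1) = k * k"
    by (cases k) auto
  have e: "k + l + k * (k - 1) = l + k * k"
    using kk by simp
  have "(1 - q ^ (2 * k)) * q ^ (l + j * k\<^sup>2)
    = q ^ (j * (n + k * (k - 1))) * (1 - q ^ (n + k)) - q ^ (j * (n + Suc k * k)) * (1 - q ^ l)"
    using assms(2)
  proof (elim insertE emptyE)
    assume "j = 0"
    then show ?thesis
      by (simp add: n power_add power2_eq_square mult_2 mult_2_right algebra_simps)
  next
    assume j: "j = 1"
    show ?thesis
      unfolding j n mult_1 e
      by (simp add: power_add power2_eq_square mult_2 mult_2_right algebra_simps)
  qed
  then show ?thesis
    using one_minus_q_nonzero by (simp add: n qint_def diff_divide_distrib[symmetric])
qed

section \<open>The sum as a function of r and n, its value at r = 0 and its recursion\<close>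

definition qsum :: "nat \<Rightarrow> nat \<Rightarrow> nat \<Rightarrow> nat \<Rightarrow> int poly fract" where
  "qsum j a r n = (\<Sum>k=a..n. qint (2 * k) * qint k ^ (2 * r)
      * q ^ ((r + 1) * (n - k) + j * k\<^sup>2) * qbinom (2 * n) (n - k))"

lemma qsum_0:
  assumes "a \<le> n" and j: "j \<in> {0, 1}"
  shows "qsum j a 0 n
    = q ^ (j * (n + a * (a - 1))) * (qint (n + a) * qbinom (2 * n) (n - a))"
  using assms(1)
proof (induction a rule: inc_induct)
  case base
  \<comment> \<open>At k = n the subtracted part has the factor \<open>qint 0\<close>, so the single
    summand is already the closed form.\<close>
  then show ?case
    using qint_double_telescope[of n n j] j by (simp add: qsum_def mult_2)
next
  case (step k)
  \<comment> \<open>Absorption turns the subtracted part at \<open>k\<close> into the closed form of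
    the tail starting at \<open>Suc k\<close>, so the two cancel.\<close>
  have "qint (n - k) * qbinom (2 * n) (n - k)
      = qint (n + Suc k) * qbinom (2 * n) (n - Suc k)"
    using qint_mult_qbinom_Suc[of "n - Suc k" "2 * n"] step.hyps
    by (simp add: Suc_diff_Suc mult_2)
  then have absorb: "q ^ (j * (n + Suc k * k)) * (qint (n - k) * qbinom (2 * n) (n - k))
      = qsum j (Suc k) 0 n"
    using step.IH by simp
  have "qsum j k 0 n
      = qint (2 * k) * q ^ (n - k + j * k\<^sup>2) * qbinom (2 * n) (n - k) + qsum j (Suc k) 0 n"
    unfolding qsum_def using step.hyps by (subst sum.atLeast_Suc_atMost) auto
  also have "\<dots> = q ^ (j * (n + k * (k - 1))) * (qint (n + k) * qbinom (2 * n) (n - k))"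
    unfolding qint_double_telescope[OF less_imp_le[OF step.hyps(2)] j]
      left_diff_distrib mult.assoc absorb
    by simp
  finally show ?case .
qed

lemma qsum_Suc:
  assumes "a \<le> m"
  shows "qsum j a (Suc r) (Suc m) = (qint (Suc m))\<^sup>2 * qsum j a r (Suc m)
    - q ^ Suc r * (qint (Suc (Suc (2 * m))) * qint (Suc (2 * m))) * qsum j a r m"
proof -
  define n where "n = Suc m"
  define c where "c k = qint (2 * k) * qint k ^ (2 * r)" for k
  define t where "t k = c k * q ^ ((r + 1) * (n - k) + j * k\<^sup>2) * qbinom (2 * n) (n - k)" for k
  have "qsum j a (Suc r) n = (\<Sum>k=a..n. t k * (q ^ (n - k) * (qint k)\<^sup>2))"
    unfolding qsum_def
  proof (intro sum.cong refl)
    fix k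
    have "(Suc r + 1) * (n - k) + j * k\<^sup>2 = ((r + 1) * (n - k) + j * k\<^sup>2) + (n - k)"
      by simp
    then have "q ^ ((Suc r + 1) * (n - k) + j * k\<^sup>2)
        = q ^ ((r + 1) * (n - k) + j * k\<^sup>2) * q ^ (n - k)"
      by (metis power_add)
    moreover have "qint k ^ (2 * Suc r) = qint k ^ (2 * r) * (qint k)\<^sup>2"
      by (simp add: power2_eq_square)
    ultimately show "qint (2 * k) * qint k ^ (2 * Suc r) * q ^ ((Suc r + 1) * (n - k) + j * k\<^sup>2)
          * qbinom (2 * n) (n - k)
        = t k * (q ^ (n - k) * (qint k)\<^sup>2)"
      unfolding t_def c_def by (simp only: ac_simps)
  qed
  also have "\<dots> = (\<Sum>k=a..n. (qint n)\<^sup>2 * t k - t k * (qint (n - k) * qint (n + k)))"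
    by (intro sum.cong) (auto simp: q_power_mult_qint_square algebra_simps)
  also have "\<dots> = (qint n)\<^sup>2 * qsum j a r n - (\<Sum>k=a..n. t k * (qint (n - k) * qint (n + k)))"
    by (simp add: sum_subtractf sum_distrib_left qsum_def t_def c_def)
  \<comment> \<open>The term k = n vanishes through \<open>qint (n - k)\<close>, which leaves the
    index range of the sum for \<open>m\<close>.\<close>
  also have "(\<Sum>k=a..n. t k * (qint (n - k) * qint (n + k)))
      = (\<Sum>k=a..m. t k * (qint (n - k) * qint (n + k)))"
    using assms by (simp add: n_def)
  also have "\<dots> = (\<Sum>k=a..m. q ^ Suc r * (qint (Suc (Suc (2 * m))) * qint (Suc (2 * m)))
      * (c k * q ^ ((r + 1) * (m - k) + j * k\<^sup>2) * qbinom (2 * m) (m - k)))"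
  proof (intro sum.cong refl)
    fix k
    assume "k \<in> {a..m}"
    then have k: "k \<le> m"
      by simp
    have binom: "qint (n - k) * qint (n + k) * qbinom (2 * n) (n - k)
        = qint (Suc (Suc (2 * m))) * qint (Suc (2 * m)) * qbinom (2 * m) (m - k)"
      using qint_mult_qint_mult_qbinom[of "m - k" "2 * m"] k
      by (simp add: n_def Suc_diff_le mult_2)
    \<comment> \<open>Lowering n by one lowers every exponent by r + 1, whence the common factor
      \<open>q ^ Suc r\<close>.\<close>
    have power: "q ^ ((r + 1) * (n - k) + j * k\<^sup>2)
        = q ^ Suc r * q ^ ((r + 1) * (m - k) + j * k\<^sup>2)"
    proof -
      have "n - k = Suc (m - k)"
        using k by (simp add: n_def Suc_diff_le)
      then have "(r + 1) * (n - k) + j * k\<^sup>2 = Suc r + ((r + 1) * (m - k) + j * k\<^sup>2)"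
        by simp
      then show ?thesis
        by (metis power_add)
    qed
    have "t k * (qint (n - k) * qint (n + k)) = c k * q ^ ((r + 1) * (n - k) + j * k\<^sup>2)
        * (qint (n - k) * qint (n + k) * qbinom (2 * n) (n - k))"
      by (simp only: t_def mult_ac)
    then show "t k * (qint (n - k) * qint (n + k))
        = q ^ Suc r * (qint (Suc (Suc (2 * m))) * qint (Suc (2 * m)))
          * (c k * q ^ ((r + 1) * (m - k) + j * k\<^sup>2) * qbinom (2 * m) (m - k))"
      unfolding binom power by (simp only: mult_ac)
  qed
  also have "\<dots> = q ^ Suc r * (qint (Suc (Suc (2 * m))) * qint (Suc (2 * m))) * qsum j a r m"
    by (simp add: qsum_def c_def sum_distrib_left)
  finally show ?thesis
    by (simp add: n_def)
qed

text \<open>Induction on r with n free, since the recursion also calls on the sum for n - 1. The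
  quotient is even a polynomial, as all coefficients of the recursion are.\<close>

lemma qsum_divisible:
  assumes "a \<le> n" and "j \<in> {0, 1}"
  shows "\<exists>p. qsum j a r n = to_fract p * (qint (n + a) * qbinom (2 * n) (n - a))"
  using assms(1)
proof (induction r arbitrary: n)
  case 0
  then show ?case
    using qsum_0[OF _ assms(2)] q_power_eq by metis
next
  case (Suc r)
  define F where "F n = qint (n + a) * qbinom (2 * n) (n - a)" for n
  obtain p where p: "qsum j a r n = to_fract p * F n"
    using Suc unfolding F_def by blast
  define b where "b m = (\<Sum>i<m. monom (1::int) i)" for m
  have qint_b: "qint m = to_fract (b m)" for m
    by (simp add: b_def qint_eq_to_fract)
  show ?case
  proof (cases "a = n")
    \<comment> \<open>The recursion would need a \<le> n - 1. Here only k = n is summed, and raising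
      r by one contributes just \<open>(qint n)\<^sup>2\<close>.\<close>
    case True
    have "qsum j a (Suc r) n = (qint n)\<^sup>2 * qsum j a r n"
      by (simp add: qsum_def True power2_eq_square)
    also have "\<dots> = to_fract ((b n)\<^sup>2 * p) * F n"
      by (simp add: p qint_b to_fract_power)
    finally show ?thesis
      unfolding F_def by blast
  next
    case False
    with Suc.prems obtain m where n: "n = Suc m" and "a \<le> m"
      by (metis le_SucE not0_implies_Suc le_zero_eq)
    obtain p' where p': "qsum j a r m = to_fract p' * F m"
      using Suc.IH[OF \<open>a \<le> m\<close>] unfolding F_def by blast
    \<comment> \<open>The second coefficient of the recursion is exactly what makes the modulus for
      \<open>m\<close> a polynomial multiple of the modulus for \<open>n\<close>.\<close>
    have F: "qint (Suc (Suc (2 * m))) * qint (Suc (2 * m)) * F m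
        = qint (m + a) * qint (n - a) * F n"
      using qint_mult_qint_mult_qbinom[of "m - a" "2 * m"] \<open>a \<le> m\<close>
      by (simp add: F_def n Suc_diff_le mult_2 mult_ac)
    have "qsum j a (Suc r) n = (qint n)\<^sup>2 * (to_fract p * F n)
        - q ^ Suc r * to_fract p' * (qint (Suc (Suc (2 * m))) * qint (Suc (2 * m)) * F m)"
      using p by (simp add: n qsum_Suc[OF \<open>a \<le> m\<close>] p' mult_ac)
    also have "\<dots> = to_fract ((b n)\<^sup>2 * p - monom 1 (Suc r) * p' * (b (m + a) * b (n - a))) * F n"
      unfolding F unfolding qint_b q_power_eq
      by (simp add: to_fract_power algebra_simps)
    finally show ?thesis
      unfolding F_def by blast
  qed
qed

lemma laurent_poly_to_fract: "laurent_poly (to_fract p)"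
proof -
  have "to_fract p = to_fract (\<Sum>i\<le>degree p. of_int (coeff p i) * monom 1 i)"
    by (subst poly_as_sum_of_monoms[symmetric])
      (simp add: of_int_poly smult_monom)
  also have "\<dots> = (\<Sum>i\<le>degree p. of_int (coeff p i) * q ^ i)"
    by (simp add: to_fract_of_int q_power_eq)
  \<comment> \<open>The degrees are moved into the integers because \<open>laurent_poly\<close> sums
    over integer exponents.\<close>
  also have "\<dots> = (\<Sum>i\<in>int ` {..degree p}. of_int (coeff p (nat i)) * q powi i)"
    by (simp add: sum.reindex)
  finally show ?thesis
    unfolding laurent_poly_def by (intro exI conjI) auto
qed

theorem theorem4p1:
  fixes n a r j :: nat
  assumes "n \<ge> 1" and "a \<le> n" and "j \<in> {0, 1}"
  shows "cong_zero_mod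
    (\<Sum>k=a..n. qint (2 * k) * qint k ^ (2 * r)
        * q ^ ((r + 1) * (n - k) + j * k\<^sup>2) * qbinom (2 * n) (n - k))
    (qint (n + a) * qbinom (2 * n) (n - a))"
proof -
  \<comment> \<open>Positivity of n gives n + a > 0, so the modulus does not vanish and the division
    below is genuine.\<close>
  have nz: "qint (n + a) * qbinom (2 * n) (n - a) \<noteq> 0"
    using assms by (simp add: qint_nonzero qbinom_nonzero)
  moreover obtain p
    where "qsum j a r n = to_fract p * (qint (n + a) * qbinom (2 * n) (n - a))"
    using qsum_divisible[OF assms(2,3)] by blast
  ultimately have "qsum j a r n / (qint (n + a) * qbinom (2 * n) (n - a)) = to_fract p"
    by simp
  then show ?thesis
    using nz laurent_poly_to_fract unfolding cong_zero_mod_def qsum_def by metis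
qed

end
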